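(* Let $F$ be a non-archimedean ordered field, $\mathcal{C}$ the set of all convex subgroups of $(F,+)$, and $Q=\{a+A: a\in F, A\in\mathcal{C}\}$ with operations $(a+A)+(b+B)=a+b+A+B$ and $(a+A)(b+B)=ab+aB+bA+AB$. Then $(Q,+,\cdot)$, with $e(a+A)=A$, $s(a+A)=-a+A$, and for zeroless $\alpha=a+A$ (i.e. $\alpha\notin\mathcal{C}$) $u(\alpha)=1+A/a$ and $d(\alpha)=\frac1a+\frac{A}{a^2}$, is an association.
   Context: A subset of $F$ is convex if it contains every element lying between two of its elements; sums/products of sets are elementwise, and the operations on $Q$ are independent of representatives. Assembly: a non-empty structure $(\mathcal{A},\ast)$ such that (1) $\ast$ is associative; (2) commutative; (3) for every $x$ there is $e$ with $x\ast e=x$ and such that $x\ast f=x$ implies $e\ast f=e$ (this $e$ is unique, denoted $e(x)$); (4) for every $x$ there is $s$ with $x\ast s=e(x)$ and $e(s)=e(x)$ (unique, denoted $s(x)$); (5) for all $x,y$, $e(x\ast y)=e(x)$ or $e(x\ast y)=e(y)$. Association: a structure $(\mathcal{A},+,\cdot)$ such that $(\mathcal{A},+)$ is an assembly, with neutral operator $e$ and symmetric operator $s$; letting $\mathcal{N}=\{x: x=e(x)\}$ (the magnitudes), $(\mathcal{A}\setminus\mathcal{N},\cdot)$ is an assembly, whose neutral operator is denoted $u$ and symmetric operator $d$; and for all $x,y,z$: (1) $xy+xz=x(y+z)+e(x)y+e(x)z$; (2) there is $w$ with $e(x)y=e(w)$; (3) $e(xy)=e(x)y+e(y)x$; (4)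 if $x\neq e(x)$ then $e(u(x))=e(x)d(x)$; (5) $s(xy)=s(x)y$. *)

theory Defs
  imports Complex_Main "HOL-Library.Set_Algebras"
begin

definition is_neutral :: "'a set \<Rightarrow> ('a \<Rightarrow> 'a \<Rightarrow> 'a) \<Rightarrow> 'a \<Rightarrow> 'a \<Rightarrow> bool" where
  "is_neutral S f x e \<longleftrightarrow> e \<in> S \<and> f x e = x \<and> (\<forall>y\<in>S. f x y = x \<longrightarrow> f e y = e)"

definition neutral_op :: "'a set \<Rightarrow> ('a \<Rightarrow> 'a \<Rightarrow> 'a) \<Rightarrow> 'a \<Rightarrow> 'a" where
  "neutral_op S f x = (THE e. is_neutral S f x e)"

definition is_symmetric :: "'a set \<Rightarrow> ('a \<Rightarrow> 'a \<Rightarrow> 'a) \<Rightarrow> 'a \<Rightarrow> 'a \<Rightarrow> bool" where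
  "is_symmetric S f x s \<longleftrightarrow>
     s \<in> S \<and> f x s = neutral_op S f x \<and> neutral_op S f s = neutral_op S f x"

definition symmetric_op :: "'a set \<Rightarrow> ('a \<Rightarrow> 'a \<Rightarrow> 'a) \<Rightarrow> 'a \<Rightarrow> 'a" where
  "symmetric_op S f x = (THE s. is_symmetric S f x s)"

definition assembly :: "'a set \<Rightarrow> ('a \<Rightarrow> 'a \<Rightarrow> 'a) \<Rightarrow> bool" where
  "assembly S f \<longleftrightarrow>
     S \<noteq> {} \<and>
     (\<forall>x\<in>S. \<forall>y\<in>S. f x y \<in> S) \<and>
     (\<forall>x\<in>S. \<forall>y\<in>S. \<forall>z\<in>S. f x (f y z) = f (f x y) z) \<and>
     (\<forall>x\<in>S. \<forall>y\<in>S. f x y = f y x) \<and>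
     (\<forall>x\<in>S. \<exists>e. is_neutral S f x e) \<and>
     (\<forall>x\<in>S. \<exists>s. is_symmetric S f x s) \<and>
     (\<forall>x\<in>S. \<forall>y\<in>S. neutral_op S f (f x y) = neutral_op S f x \<or>
                   neutral_op S f (f x y) = neutral_op S f y)"

definition magnitudes :: "'a set \<Rightarrow> ('a \<Rightarrow> 'a \<Rightarrow> 'a) \<Rightarrow> 'a set" where
  "magnitudes S f = {x \<in> S. x = neutral_op S f x}"

definition association :: "'a set \<Rightarrow> ('a \<Rightarrow> 'a \<Rightarrow> 'a) \<Rightarrow> ('a \<Rightarrow> 'a \<Rightarrow> 'a) \<Rightarrow> bool" where
  "association S p m \<longleftrightarrow>
     (let e = neutral_op S p; s = symmetric_op S p; Z = S - magnitudes S p;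
          u = neutral_op Z m; d = symmetric_op Z m
      in assembly S p \<and>
         (\<forall>x\<in>S. \<forall>y\<in>S. m x y \<in> S) \<and>
         assembly Z m \<and>
         (\<forall>x\<in>S. \<forall>y\<in>S. \<forall>z\<in>S.
            p (m x y) (m x z) = p (p (m x (p y z)) (m (e x) y)) (m (e x) z)) \<and>
         (\<forall>x\<in>S. \<forall>y\<in>S. \<exists>w\<in>S. m (e x) y = e w) \<and>
         (\<forall>x\<in>S. \<forall>y\<in>S. e (m x y) = p (m (e x) y) (m (e y) x)) \<and>
         (\<forall>x\<in>S. x \<noteq> e x \<longrightarrow> e (u x) = m (e x) (d x)) \<and>
         (\<forall>x\<in>S. \<forall>y\<in>S. s (m x y) = m (s x) y))"

lemma is_neutral_unique:
  assumes "assembly S f" "is_neutral S f x e" "is_neutral S f x e'"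
  shows "e = e'"
proof -
  have e: "e \<in> S" "e' \<in> S" "f x e = x" "f x e' = x"
    using assms(2,3) unfolding is_neutral_def by blast+
  have "f e e' = e" "f e' e = e'" using assms(2,3) e unfolding is_neutral_def by blast+
  moreover have "f e e' = f e' e" using assms(1) e unfolding assembly_def by blast
  ultimately show ?thesis by simp
qed

lemma neutral_op_eqI:
  assumes "assembly S f" "is_neutral S f x e"
  shows "neutral_op S f x = e"
  unfolding neutral_op_def
  by (rule the_equality) (auto intro: assms(2) is_neutral_unique[OF assms(1) _ assms(2)])

lemma is_symmetric_unique:
  assumes S: "assembly S f" and x: "x \<in> S"
    and s: "is_symmetric S f x s" and t: "is_symmetric S f x t"
  shows "s = t"
proof -
  have ne: "f y (neutral_op S f y) = y" if "y \<in> S" for y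
  proof -
    obtain e where "is_neutral S f y e" using S \<open>y \<in> S\<close> unfolding assembly_def by blast
    then show ?thesis using neutral_op_eqI[OF S] by (simp add: is_neutral_def)
  qed
  have assoc: "f a (f b c) = f (f a b) c" and comm: "f a b = f b a"
    if "a \<in> S" "b \<in> S" "c \<in> S" for a b c
    using S that unfolding assembly_def by blast+
  have st: "s \<in> S" "t \<in> S" using s t by (auto simp: is_symmetric_def)
  have "s = f s (f x t)" using ne[OF st(1)] s t by (simp add: is_symmetric_def)
  also have "\<dots> = f t (f x s)" using assoc comm st x by metis
  also have "\<dots> = t" using ne[OF st(2)] s t by (simp add: is_symmetric_def)
  finally show ?thesis .
qed

definition order_convex :: "'a::order set \<Rightarrow> bool" where
  "order_convex S \<longleftrightarrow> (\<forall>x\<in>S. \<forall>y\<in>S. \<forall>z. x \<le> z \<and> z \<le> y \<longrightarrow> z \<in> S)"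

definition add_subgroup :: "'a::ab_group_add set \<Rightarrow> bool" where
  "add_subgroup A \<longleftrightarrow> 0 \<in> A \<and> (\<forall>x\<in>A. \<forall>y\<in>A. x + y \<in> A) \<and> (\<forall>x\<in>A. - x \<in> A)"

definition convex_subgroups :: "'a::linordered_field set set" where
  "convex_subgroups = {A. add_subgroup A \<and> order_convex A}"

definition cosets :: "'a::linordered_field set set" where
  "cosets = {a +o A | a A. A \<in> convex_subgroups}"

text \<open>The operations on cosets are given by formulas in representatives; below they are shown
  not to depend on the choice.  Outside \<^const>\<open>cosets\<close> their values are irrelevant.\<close>

definition coset_add :: "'a::linordered_field set \<Rightarrow> 'a set \<Rightarrow> 'a set" where
  "coset_add \<alpha> \<beta> = (THE \<gamma>. \<forall>a b. \<forall>A\<in>convex_subgroups. \<forall>B\<in>convex_subgroups.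
     \<alpha> = a +o A \<and> \<beta> = b +o B \<longrightarrow> \<gamma> = (a + b) +o (A + B))"

definition coset_mult :: "'a::linordered_field set \<Rightarrow> 'a set \<Rightarrow> 'a set" where
  "coset_mult \<alpha> \<beta> = (THE \<gamma>. \<forall>a b. \<forall>A\<in>convex_subgroups. \<forall>B\<in>convex_subgroups.
     \<alpha> = a +o A \<and> \<beta> = b +o B \<longrightarrow> \<gamma> = (a * b) +o (a *o B + b *o A + A * B))"

lemma convex_subgroupsD:
  assumes "A \<in> convex_subgroups"
  shows "0 \<in> A" "x \<in> A \<Longrightarrow> y \<in> A \<Longrightarrow> x + y \<in> A" "x \<in> A \<Longrightarrow> - x \<in> A"
    "x \<in> A \<Longrightarrow> y \<in> A \<Longrightarrow> x - y \<in> A"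
    "x \<in> A \<Longrightarrow> y \<in> A \<Longrightarrow> x \<le> z \<Longrightarrow> z \<le> y \<Longrightarrow> z \<in> A"
proof -
  show 0: "0 \<in> A" and add: "x \<in> A \<Longrightarrow> y \<in> A \<Longrightarrow> x + y \<in> A" and minus: "x \<in> A \<Longrightarrow> - x \<in> A"
    and "x \<in> A \<Longrightarrow> y \<in> A \<Longrightarrow> x \<le> z \<Longrightarrow> z \<le> y \<Longrightarrow> z \<in> A" for x y z
    using assms unfolding convex_subgroups_def add_subgroup_def order_convex_def by blast+
  show "x - y \<in> A" if "x \<in> A" "y \<in> A"
    using add[OF that(1) minus[OF that(2)]] by simp
qed

lemma convex_subgroups_abs:
  assumes A: "A \<in> convex_subgroups" and "x \<in> A" "\<bar>z\<bar> \<le> \<bar>x\<bar>"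
  shows "z \<in> A"
proof -
  have "\<bar>x\<bar> \<in> A" using assms convex_subgroupsD(3)[OF A] by (auto simp: abs_if)
  moreover have "- \<bar>x\<bar> \<le> z" "z \<le> \<bar>x\<bar>" using assms(3) by linarith+
  ultimately show ?thesis using convex_subgroupsD(3,5)[OF A] by blast
qed

lemma convex_subgroups_times_add:
  assumes A: "A \<in> convex_subgroups" and B: "B \<in> convex_subgroups"
    and "p \<in> A * B" "q \<in> A * B"
  shows "p + q \<in> A * B"
proof -
  obtain x y x' y' where xy: "x \<in> A" "y \<in> B" "x' \<in> A" "y' \<in> B" "p = x * y" "q = x' * y'"
    using assms(3,4) by (auto elim!: set_times_elim)
  define X where "X = max \<bar>x\<bar> \<bar>x'\<bar>"
  define Y where "Y = max \<bar>y\<bar> \<bar>y'\<bar>"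
  have X: "X \<in> A" unfolding X_def max_def using convex_subgroups_abs[OF A] xy by simp
  have Y: "Y \<in> B" unfolding Y_def max_def using convex_subgroups_abs[OF B] xy by simp
  have le: "\<bar>p + q\<bar> \<le> X * (Y + Y)"
  proof -
    have "\<bar>p\<bar> \<le> X * Y" "\<bar>q\<bar> \<le> X * Y"
      unfolding xy abs_mult X_def Y_def by (intro mult_mono; simp add: le_max_iff_disj)+
    then show ?thesis by (simp add: distrib_left)
  qed
  show ?thesis
  proof (cases "X = 0")
    case True
    then have "p + q = 0 * 0" using le by simp
    then show ?thesis using convex_subgroupsD(1)[OF A] convex_subgroupsD(1)[OF B]
      by (metis set_times_intro)
  next
    case False
    then have pos: "X > 0" unfolding X_def by (auto simp: less_max_iff_disj max_def split: if_splits)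
    have "\<bar>(p + q) / X\<bar> \<le> \<bar>Y + Y\<bar>"
    proof -
      have "\<bar>(p + q) / X\<bar> \<le> Y + Y"
        using le pos by (simp add: abs_divide pos_divide_le_eq mult.commute)
      then show ?thesis by linarith
    qed
    then have "(p + q) / X \<in> B" using convex_subgroups_abs[OF B] convex_subgroupsD(2)[OF B] Y by blast
    then have "X * ((p + q) / X) \<in> A * B" using X by blast
    then show ?thesis using False by simp
  qed
qed

lemma elt_set_plus_eqD:
  assumes A: "A \<in> convex_subgroups" and A': "A' \<in> convex_subgroups" and eq: "a +o A = a' +o A'"
  shows "A' = A" "a' - a \<in> A"
proof -
  have mem: "x - a \<in> A \<longleftrightarrow> x - a' \<in> A'" for x
    using eq by (metis set_minus_plus)
  show d: "a' - a \<in> A" using mem[of a'] convex_subgroupsD(1)[OF A'] by simp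
  have "x \<in> A' \<longleftrightarrow> x \<in> A" for x
  proof -
    have "x \<in> A' \<longleftrightarrow> x + (a' - a) \<in> A" using mem[of "x + a'"] by (simp add: algebra_simps)
    also have "\<dots> \<longleftrightarrow> x \<in> A"
      using d convex_subgroupsD(2,4)[OF A] by (metis add_diff_cancel_right')
    finally show ?thesis .
  qed
  then show "A' = A" by blast
qed

lemma coset_add_eq:
  assumes A: "A \<in> convex_subgroups" and B: "B \<in> convex_subgroups"
  shows "coset_add (a +o A) (b +o B) = (a + b) +o (A + B)"
proof -
  have "(a + b) +o (A + B) = (a' + b') +o (A' + B')"
    if "A' \<in> convex_subgroups" "B' \<in> convex_subgroups" "a +o A = a' +o A'" "b +o B = b' +o B'"
    for a' b' A' B'
    using that by (metis set_plus_rearrange)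
  then show ?thesis unfolding coset_add_def using A B by (intro the_equality) blast+
qed

lemma coset_mult_subset:
  assumes A: "A \<in> convex_subgroups" and B: "B \<in> convex_subgroups"
    and x: "a' - a \<in> A" and y: "b' - b \<in> B"
  shows "(a' * b') +o (a' *o B + b' *o A + A * B) \<subseteq> (a * b) +o (a *o B + b *o A + A * B)"
proof
  fix t assume "t \<in> (a' * b') +o (a' *o B + b' *o A + A * B)"
  then obtain \<beta> \<alpha> q where t: "t = a' * b' + (a' * \<beta> + b' * \<alpha> + q)" "\<beta> \<in> B" "\<alpha> \<in> A" "q \<in> A * B"
    by (auto simp: elt_set_plus_def elt_set_times_def set_plus_def)
  define x where "x = a' - a"
  define y where "y = b' - b"
  have xy: "x \<in> A" "y \<in> B" using assms by (auto simp: x_def y_def)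
  have ab: "a' = a + x" "b' = b + y" by (auto simp: x_def y_def)
  have "x * y + x * \<beta> + \<alpha> * y + q \<in> A * B"
    using t xy by (intro convex_subgroups_times_add[OF A B]) auto
  moreover have "y + \<beta> \<in> B" "x + \<alpha> \<in> A" using t xy convex_subgroupsD(2) A B by blast+
  moreover have "t = a * b + (a * (y + \<beta>) + b * (x + \<alpha>) + (x * y + x * \<beta> + \<alpha> * y + q))"
    unfolding t ab by (simp add: algebra_simps)
  ultimately show "t \<in> (a * b) +o (a *o B + b *o A + A * B)"
    by (auto intro!: set_plus_intro2 set_plus_intro set_times_intro2)
qed

lemma coset_mult_eq:
  assumes A: "A \<in> convex_subgroups" and B: "B \<in> convex_subgroups"
  shows "coset_mult (a +o A) (b +o B) = (a * b) +o (a *o B + b *o A + A * B)"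
proof -
  have "(a * b) +o (a *o B + b *o A + A * B) = (a' * b') +o (a' *o B' + b' *o A' + A' * B')"
    if h: "A' \<in> convex_subgroups" "B' \<in> convex_subgroups" "a +o A = a' +o A'" "b +o B = b' +o B'"
    for a' b' A' B'
  proof -
    have e: "A' = A" "a' - a \<in> A" "B' = B" "b' - b \<in> B"
      using elt_set_plus_eqD A B h by blast+
    then have "a - a' \<in> A" "b - b' \<in> B"
      using convex_subgroupsD(3)[OF A, of "a' - a"] convex_subgroupsD(3)[OF B, of "b' - b"] by simp_all
    then show ?thesis using e coset_mult_subset[OF A B] by (metis subset_antisym)
  qed
  then show ?thesis unfolding coset_mult_def using A B by (intro the_equality) blast+
qed

end

theory Submission
  imports Defs
begin

text \<open>
  Convex subgroups of \<open>F\<close> are linearly ordered by inclusion, so a sum \<open>A + B\<close> is always the larger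
  of the two.  Hence products distribute over sums of convex subgroups, and the laws of an
  association become identities in the semiring of convex subgroups.  If \<open>a \<notin> A\<close> then every element
  of \<open>A\<close> is smaller than \<open>a\<close> in absolute value, so \<open>A B \<subseteq> a B\<close>; thus the product of two zeroless
  cosets is \<open>a b + (a B + b A)\<close>, and dividing by \<open>a b\<close> turns its neutral part into \<open>B / b + A / a\<close>,
  again the larger of the two.
\<close>

section \<open>Neutral elements of commutative structures\<close>

text \<open>The assembly axioms on symmetric elements and on \<open>e(x*y)\<close> already mention
  \<open>neutral_op\<close>, so it has to be computed before \<open>assembly\<close> is available.
  Two neutral elements of \<open>x\<close> absorb each other, and commutativity alone then
  identifies them.\<close>

lemma neutral_op_eq_if_commutative:
  assumes comm: "\<And>x y. x \<in> S \<Longrightarrow> y \<in> S \<Longrightarrow> f x y = f y x" and e: "is_neutral S f x e"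
  shows "neutral_op S f x = e"
  unfolding neutral_op_def
proof (rule the_equality[where P = "is_neutral S f x", OF e])
  fix e' assume "is_neutral S f x e'"
  then have "e' \<in> S" "e \<in> S" "f e e' = e" "f e' e = e'"
    using e unfolding is_neutral_def by blast+
  then show "e' = e" using comm by metis
qed

lemma symmetric_op_eqI:
  assumes "assembly S f" "x \<in> S" "is_symmetric S f x s"
  shows "symmetric_op S f x = s"
  unfolding symmetric_op_def
  by (rule the_equality) (auto intro: assms(3) is_symmetric_unique[OF assms(1,2) _ assms(3)])

section \<open>The semiring of convex subgroups\<close>

text \<open>Closure under smaller absolute values covers both negation and convexity: an element
  between \<open>x\<close> and \<open>y\<close> is bounded in absolute value by one of them.\<close>

lemma convex_subgroupsI:
  assumes "0 \<in> A" and "\<And>x y. x \<in> A \<Longrightarrow> y \<in> A \<Longrightarrow> x + y \<in> A"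
    and abs: "\<And>x z. x \<in> A \<Longrightarrow> \<bar>z\<bar> \<le> \<bar>x\<bar> \<Longrightarrow> z \<in> A"
  shows "A \<in> convex_subgroups"
proof -
  have "- x \<in> A" if "x \<in> A" for x using abs[OF that, of "- x"] by simp
  then have "add_subgroup A" using assms(1,2) unfolding add_subgroup_def by blast
  moreover have "order_convex A"
    unfolding order_convex_def
  proof (intro ballI allI impI)
    fix x y z assume xy: "x \<in> A" "y \<in> A" and "x \<le> z \<and> z \<le> y"
    then have "\<bar>z\<bar> \<le> \<bar>x\<bar> \<or> \<bar>z\<bar> \<le> \<bar>y\<bar>" by linarith
    then show "z \<in> A" using abs xy by blast
  qed
  ultimately show ?thesis unfolding convex_subgroups_def by blast
qed

text \<open>Given \<open>x\<close> in \<open>A\<close> only and \<open>y\<close> in \<open>B\<close>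
  only, compare absolute values: the smaller of the two would be drawn into the other
  subgroup.\<close>

lemma convex_subgroups_linear:
  assumes "A \<in> convex_subgroups" "B \<in> convex_subgroups"
  shows "A \<subseteq> B \<or> B \<subseteq> A"
proof (rule ccontr)
  assume "\<not> ?thesis"
  then obtain x y where "x \<in> A" "x \<notin> B" "y \<in> B" "y \<notin> A" by blast
  then show False
    using convex_subgroups_abs[OF assms(1), of x y] convex_subgroups_abs[OF assms(2), of y x]
    by linarith
qed

lemma convex_subgroups_plus_absorb:
  assumes A: "A \<in> convex_subgroups" and B: "B \<in> convex_subgroups" and "A \<subseteq> B"
  shows "A + B = B" "B + A = B"
proof -
  show "A + B = B"
  proof
    show "A + B \<subseteq> B" using assms convex_subgroupsD(2)[OF B] by (auto elim!: set_plus_elim)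
    show "B \<subseteq> A + B" using set_zero_plus2[OF convex_subgroupsD(1)[OF A]] .
  qed
  then show "B + A = B" by (simp add: add.commute)
qed

lemma convex_subgroups_plus_idem: "A \<in> convex_subgroups \<Longrightarrow> A + A = A"
  by (simp add: convex_subgroups_plus_absorb)

lemma convex_subgroups_plus_cases:
  assumes "A \<in> convex_subgroups" "B \<in> convex_subgroups"
  shows "A + B = A \<or> A + B = B"
  using convex_subgroups_linear[OF assms] convex_subgroups_plus_absorb assms by blast

lemma convex_subgroups_plus:
  "A \<in> convex_subgroups \<Longrightarrow> B \<in> convex_subgroups \<Longrightarrow> A + B \<in> convex_subgroups"
  using convex_subgroups_plus_cases by metis

lemma zero_convex_subgroup: "{0} \<in> convex_subgroups"
  by (rule convex_subgroupsI) auto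

lemma convex_subgroups_scale:
  assumes A: "A \<in> convex_subgroups"
  shows "a *o A \<in> convex_subgroups"
proof (rule convex_subgroupsI)
  show "0 \<in> a *o A" using set_times_intro2[OF convex_subgroupsD(1)[OF A], of a] by simp
  show "x + y \<in> a *o A" if xy: "x \<in> a *o A" "y \<in> a *o A" for x y
  proof -
    obtain p q where "p \<in> A" "q \<in> A" "x = a * p" "y = a * q"
      using xy unfolding elt_set_times_def by blast
    then show ?thesis
      using set_times_intro2[OF convex_subgroupsD(2)[OF A], of p q a] by (simp add: distrib_left)
  qed
  show "z \<in> a *o A" if x: "x \<in> a *o A" "\<bar>z\<bar> \<le> \<bar>x\<bar>" for x z
  proof -
    obtain p where p: "p \<in> A" "x = a * p" using x(1) unfolding elt_set_times_def by blast
    show ?thesis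
    \<comment> \<open>For nonzero \<open>a\<close>, \<open>z / a\<close> is the preimage of
      \<open>z\<close>. For \<open>a = 0\<close> the bound forces \<open>z = 0\<close>, and 0 is in
      every multiple.\<close>
    proof (cases "a = 0")
      case True
      then show ?thesis
        using x p set_times_intro2[OF convex_subgroupsD(1)[OF A], of a] by simp
    next
      case False
      then have "\<bar>z / a\<bar> \<le> \<bar>p\<bar>"
        using x(2) p by (simp add: abs_mult abs_divide pos_divide_le_eq mult.commute)
      then have "a * (z / a) \<in> a *o A" using convex_subgroups_abs[OF A p(1)] by blast
      then show ?thesis using False by simp
    qed
  qed
qed

lemma convex_subgroups_times:
  assumes A: "A \<in> convex_subgroups" and B: "B \<in> convex_subgroups"
  shows "A * B \<in> convex_subgroups"
proof (rule convex_subgroupsI)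
  show "0 \<in> A * B"
    using set_times_intro[OF convex_subgroupsD(1)[OF A] convex_subgroupsD(1)[OF B]] by simp
  show "x + y \<in> A * B" if "x \<in> A * B" "y \<in> A * B" for x y
    using convex_subgroups_times_add[OF A B that] .
  show "z \<in> A * B" if x: "x \<in> A * B" "\<bar>z\<bar> \<le> \<bar>x\<bar>" for x z
  proof -
    obtain p q where pq: "p \<in> A" "q \<in> B" "x = p * q" using x(1) by (auto elim!: set_times_elim)
    \<comment> \<open>With one factor \<open>p\<close> fixed, \<open>p *o B\<close> is a convex
      subgroup containing \<open>x\<close>, hence \<open>z\<close>, and it lies inside
      \<open>A * B\<close>.\<close>
    then have "z \<in> p *o B"
      using convex_subgroups_abs[OF convex_subgroups_scale[OF B], of x p z] x by blast
    then show ?thesis using pq(1) set_times_mono3 by blast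
  qed
qed

text \<open>For arbitrary sets only the inclusion from left to right holds. Here one of
  \<open>B\<close>, \<open>C\<close> contains the other, and as multiplication is monotone both
  sides equal the larger of \<open>A * B\<close> and \<open>A * C\<close>.\<close>

lemma convex_subgroups_distrib_left:
  assumes A: "A \<in> convex_subgroups" and B: "B \<in> convex_subgroups" and C: "C \<in> convex_subgroups"
  shows "A * (B + C) = A * B + A * C"
proof -
  have *: "A * B \<in> convex_subgroups" "A * C \<in> convex_subgroups"
    using convex_subgroups_times assms by auto
  consider "B \<subseteq> C" | "C \<subseteq> B" using convex_subgroups_linear[OF B C] by blast
  then show ?thesis
  proof cases
    case 1
    then show ?thesis
      using convex_subgroups_plus_absorb(1)[OF B C] convex_subgroups_plus_absorb(1)[OF *]
        set_times_mono2[of A A B C] by simp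
  next
    case 2
    then show ?thesis
      using convex_subgroups_plus_absorb(2)[OF C B] convex_subgroups_plus_absorb(2)[OF *(2,1)]
        set_times_mono2[of A A C B] by simp
  qed
qed

lemma convex_subgroups_distrib_right:
  assumes "A \<in> convex_subgroups" "B \<in> convex_subgroups" "C \<in> convex_subgroups"
  shows "(B + C) * A = B * A + C * A"
  using convex_subgroups_distrib_left[OF assms] by (simp add: mult.commute)

section \<open>Multiples of convex subgroups by field elements\<close>

lemma scale_plus_distrib: "a *o (B + C) = a *o B + a *o (C :: 'a::linordered_field set)"
  by (simp add: set_times_plus_distribs)

lemma scale_times: "(a *o A) * B = a *o (A * (B :: 'a::linordered_field set))"
  "B * (a *o A) = a *o (B * A)"
  by (simp_all add: set_times_rearrange3 set_times_rearrange4)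

lemma scale_zero: "A \<in> convex_subgroups \<Longrightarrow> 0 *o A = {0}"
  using convex_subgroupsD(1) by (auto simp: elt_set_times_def)

lemma scale_minus:
  assumes "A \<in> convex_subgroups"
  shows "(- a) *o A = a *o A"
proof -
  have "(- b) *o A \<subseteq> b *o A" for b
  proof
    fix t assume "t \<in> (- b) *o A"
    then obtain x where "x \<in> A" "t = b * (- x)" by (auto simp: elt_set_times_def)
    then show "t \<in> b *o A" using convex_subgroupsD(3)[OF assms] by blast
  qed
  from this[of a] this[of "- a"] show ?thesis by simp
qed

text \<open>The inclusion can be strict, as for \<open>c = - b\<close> with \<open>b\<close> and
  \<open>A\<close> nonzero. This cancellation is why distributivity of cosets needs correction
  terms.\<close>

lemma scale_add_subset: "(b + c) *o A \<subseteq> b *o A + c *o (A :: 'a::linordered_field set)"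
proof
  fix t assume "t \<in> (b + c) *o A"
  then obtain x where "x \<in> A" "t = b * x + c * x"
    unfolding elt_set_times_def by (auto simp: distrib_right)
  then show "t \<in> b *o A + c *o A" by blast
qed

text \<open>An \<open>x\<close> in \<open>A\<close> with absolute value above that of
  \<open>a\<close> would force \<open>a\<close> into \<open>A\<close> by convexity.\<close>

lemma times_subset_scale:
  assumes A: "A \<in> convex_subgroups" and B: "B \<in> convex_subgroups" and a: "a \<notin> A"
  shows "A * B \<subseteq> a *o B"
proof
  fix t assume "t \<in> A * B"
  then obtain x y where xy: "x \<in> A" "y \<in> B" "t = x * y" by (auto elim!: set_times_elim)
  have "\<bar>x\<bar> \<le> \<bar>a\<bar>" using convex_subgroups_abs[OF A xy(1), of a] a by linarith
  then have "\<bar>t\<bar> \<le> \<bar>a * y\<bar>" using xy by (simp add: abs_mult mult_right_mono)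
  then show "t \<in> a *o B"
    using convex_subgroups_abs[OF convex_subgroups_scale[OF B]] xy(2) by blast
qed

lemmas convex_subgroups_closed =
  convex_subgroups_plus convex_subgroups_scale convex_subgroups_times zero_convex_subgroup

lemmas convex_subgroups_semiring =
  convex_subgroups_closed convex_subgroups_distrib_left convex_subgroups_distrib_right
  scale_plus_distrib scale_times set_times_rearrange2

section \<open>Cosets under addition\<close>

lemma coset_eqI:
  assumes A: "A \<in> convex_subgroups" and d: "b - a \<in> A"
  shows "a +o A = b +o A"
proof -
  have "x - a \<in> A \<longleftrightarrow> x - b \<in> A" for x
    using convex_subgroupsD(4)[OF A _ d, of "x - a"] convex_subgroupsD(2)[OF A _ d, of "x - b"]
    by fastforce
  then show ?thesis unfolding set_eq_iff set_minus_plus[symmetric] by blast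
qed

lemma coset_absorb: "A \<in> convex_subgroups \<Longrightarrow> a \<in> A \<Longrightarrow> a +o A = A"
  using coset_eqI[of A a 0] convex_subgroupsD(3)[of A a] by simp

lemma cosetsI: "A \<in> convex_subgroups \<Longrightarrow> a +o A \<in> cosets"
  unfolding cosets_def by blast

lemma cosetsE:
  assumes "\<alpha> \<in> cosets"
  obtains a A where "A \<in> convex_subgroups" "\<alpha> = a +o A"
  using assms unfolding cosets_def by blast

lemma convex_subgroup_in_cosets: "A \<in> convex_subgroups \<Longrightarrow> A \<in> cosets"
  using cosetsI[of A 0] by simp

lemma coset_add_commute: "\<alpha> \<in> cosets \<Longrightarrow> \<beta> \<in> cosets \<Longrightarrow> coset_add \<alpha> \<beta> = coset_add \<beta> \<alpha>"
  by (elim cosetsE) (simp add: coset_add_eq add.commute)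

lemma coset_neutral:
  assumes A: "A \<in> convex_subgroups"
  shows "is_neutral cosets coset_add (a +o A) A"
  unfolding is_neutral_def
proof (intro conjI ballI impI)
  show "A \<in> cosets" by (rule convex_subgroup_in_cosets[OF A])
  show "coset_add (a +o A) A = a +o A"
    using coset_add_eq[OF A A, of a 0] by (simp add: convex_subgroups_plus_idem[OF A])
  fix \<beta> assume "\<beta> \<in> cosets" and eq: "coset_add (a +o A) \<beta> = a +o A"
  then obtain b B where B: "B \<in> convex_subgroups" "\<beta> = b +o B" by (elim cosetsE)
  then have "a +o A = (a + b) +o (A + B)" using eq by (simp add: coset_add_eq A)
  \<comment> \<open>A coset determines its subgroup, and its representative up to that subgroup. So
    \<open>B\<close> is absorbed by \<open>A\<close> and \<open>b\<close> lies in \<open>A\<close>,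
    which makes \<open>A\<close> absorb all of \<open>\<beta>\<close>.\<close>
  from elt_set_plus_eqD[OF A convex_subgroups_plus[OF A B(1)] this]
  have "A + B = A" "b \<in> A" by simp_all
  then show "coset_add A \<beta> = A"
    using coset_add_eq[OF A B(1), of 0 b] B(2) coset_absorb[OF A] by simp
qed

lemma coset_neutral_op:
  "A \<in> convex_subgroups \<Longrightarrow> neutral_op cosets coset_add (a +o A) = A"
  by (rule neutral_op_eq_if_commutative[OF coset_add_commute coset_neutral])

lemma coset_is_symmetric:
  assumes A: "A \<in> convex_subgroups"
  shows "is_symmetric cosets coset_add (a +o A) ((- a) +o A)"
  unfolding is_symmetric_def
  using A by (simp add: cosetsI coset_neutral_op coset_add_eq convex_subgroups_plus_idem)

lemma coset_add_closed: "\<alpha> \<in> cosets \<Longrightarrow> \<beta> \<in> cosets \<Longrightarrow> coset_add \<alpha> \<beta> \<in> cosets"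
  by (elim cosetsE) (simp add: coset_add_eq cosetsI convex_subgroups_plus)

lemma assembly_cosets: "assembly (cosets :: 'a::linordered_field set set) coset_add"
  unfolding assembly_def
proof (intro conjI ballI)
  show "(cosets :: 'a set set) \<noteq> {}" using convex_subgroup_in_cosets[OF zero_convex_subgroup] by blast
  fix x y :: "'a set" assume x: "x \<in> cosets" and y: "y \<in> cosets"
  then obtain a A b B where r: "A \<in> convex_subgroups" "x = a +o A" "B \<in> convex_subgroups" "y = b +o B"
    by (elim cosetsE)
  show "coset_add x y \<in> cosets" by (rule coset_add_closed[OF x y])
  show "coset_add x y = coset_add y x" by (rule coset_add_commute[OF x y])
  \<comment> \<open>The neutral part of the sum is \<open>A + B\<close>, which by linearity of
    inclusion is \<open>A\<close> or \<open>B\<close>.\<close>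
  show "neutral_op cosets coset_add (coset_add x y) = neutral_op cosets coset_add x \<or>
        neutral_op cosets coset_add (coset_add x y) = neutral_op cosets coset_add y"
    using convex_subgroups_plus_cases[OF r(1,3)] r
    by (simp add: coset_add_eq coset_neutral_op convex_subgroups_plus)
  fix z :: "'a set" assume "z \<in> cosets"
  then obtain c C where "C \<in> convex_subgroups" "z = c +o C" by (elim cosetsE)
  then show "coset_add x (coset_add y z) = coset_add (coset_add x y) z"
    using r by (simp add: coset_add_eq convex_subgroups_plus add.assoc)
next
  fix x :: "'a set" assume "x \<in> cosets"
  then obtain a A where "A \<in> convex_subgroups" "x = a +o A" by (elim cosetsE)
  then show "\<exists>e. is_neutral cosets coset_add x e" "\<exists>s. is_symmetric cosets coset_add x s"
    using coset_neutral coset_is_symmetric by blast+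
qed

lemma coset_symmetric_op:
  "A \<in> convex_subgroups \<Longrightarrow> symmetric_op cosets coset_add (a +o A) = (- a) +o A"
  by (rule symmetric_op_eqI[OF assembly_cosets cosetsI coset_is_symmetric])

section \<open>Zeroless cosets under multiplication\<close>

text \<open>The body is literally the carrier \<open>Z\<close> in \<open>association\<close>, so
  that the definition can be folded there.\<close>

definition zeroless :: "'a::linordered_field set set" where
  "zeroless = cosets - magnitudes cosets coset_add"

lemma coset_in_magnitudes_iff:
  assumes A: "A \<in> convex_subgroups"
  shows "a +o A \<in> magnitudes cosets coset_add \<longleftrightarrow> a \<in> A"
proof -
  have "a +o A = A \<longleftrightarrow> a \<in> A"
    using coset_absorb[OF A] convex_subgroupsD(1)[OF A] by (metis add.right_neutral set_plus_intro2)
  then show ?thesis using A by (simp add: magnitudes_def coset_neutral_op cosetsI)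
qed

lemma coset_in_zeroless_iff: "A \<in> convex_subgroups \<Longrightarrow> a +o A \<in> zeroless \<longleftrightarrow> a \<notin> A"
  by (simp add: zeroless_def coset_in_magnitudes_iff cosetsI)

lemma zerolessE:
  assumes "\<alpha> \<in> zeroless"
  obtains a A where "A \<in> convex_subgroups" "\<alpha> = a +o A" "a \<notin> A" "a \<noteq> 0"
proof -
  have "\<alpha> \<in> cosets" using assms by (simp add: zeroless_def)
  then obtain a A where *: "A \<in> convex_subgroups" "\<alpha> = a +o A" by (elim cosetsE)
  moreover have "a \<notin> A" using assms * by (simp add: coset_in_zeroless_iff)
  ultimately show thesis using that convex_subgroupsD(1) by metis
qed

lemma coset_mult_closed: "\<alpha> \<in> cosets \<Longrightarrow> \<beta> \<in> cosets \<Longrightarrow> coset_mult \<alpha> \<beta> \<in> cosets"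
  by (elim cosetsE) (simp add: coset_mult_eq cosetsI convex_subgroups_closed)

lemma coset_mult_commute: "\<alpha> \<in> cosets \<Longrightarrow> \<beta> \<in> cosets \<Longrightarrow> coset_mult \<alpha> \<beta> = coset_mult \<beta> \<alpha>"
  by (elim cosetsE) (simp add: coset_mult_eq mult.commute add.commute add.left_commute)

text \<open>By distributivity over sums of convex subgroups, both subgroup parts expand to the same
  seven terms: \<open>abC\<close>, \<open>acB\<close>, \<open>bcA\<close>, \<open>aBC\<close>,
  \<open>bAC\<close>, \<open>cAB\<close> and \<open>ABC\<close>.\<close>

lemma coset_mult_assoc:
  assumes "\<alpha> \<in> cosets" "\<beta> \<in> cosets" "\<gamma> \<in> cosets"
  shows "coset_mult \<alpha> (coset_mult \<beta> \<gamma>) = coset_mult (coset_mult \<alpha> \<beta>) \<gamma>"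
  using assms
  by (elim cosetsE) (simp add: coset_mult_eq convex_subgroups_semiring ac_simps)

text \<open>Since \<open>a \<notin> A\<close>, the second-order term \<open>A * B\<close> lies in
  \<open>a *o B\<close> and is absorbed there.\<close>

lemma coset_mult_zeroless:
  assumes A: "A \<in> convex_subgroups" and B: "B \<in> convex_subgroups" and "a \<notin> A"
  shows "coset_mult (a +o A) (b +o B) = (a * b) +o (a *o B + b *o A)"
proof -
  have "A * B + a *o B = a *o B"
    using times_subset_scale[OF assms] A B
    by (simp add: convex_subgroups_plus_absorb convex_subgroups_closed)
  then have "a *o B + b *o A + A * B = a *o B + b *o A"
    by (metis add.assoc add.commute)
  then show ?thesis by (simp add: coset_mult_eq[OF A B])
qed

lemma scale_mem_iff: "a \<noteq> 0 \<Longrightarrow> a * b \<in> a *o B \<longleftrightarrow> b \<in> (B :: 'a::linordered_field set)"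
  by (auto simp: elt_set_times_def)

lemma coset_mult_zeroless_closed:
  assumes "\<alpha> \<in> zeroless" "\<beta> \<in> zeroless"
  shows "coset_mult \<alpha> \<beta> \<in> zeroless"
proof -
  obtain a A b B where A: "A \<in> convex_subgroups" "\<alpha> = a +o A" "a \<notin> A" "a \<noteq> 0"
    and B: "B \<in> convex_subgroups" "\<beta> = b +o B" "b \<notin> B" "b \<noteq> 0"
    using assms by (elim zerolessE)
  \<comment> \<open>Cancelling the common factor reduces these to \<open>b \<notin> B\<close> and
    \<open>a \<notin> A\<close>; the subgroup of the product is one of the two multiples.\<close>
  have "a * b \<notin> a *o B" "a * b \<notin> b *o A"
    using A B scale_mem_iff[of a b B] scale_mem_iff[of b a A] by (simp_all add: mult.commute)
  then have "a * b \<notin> a *o B + b *o A"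
    using convex_subgroups_plus_cases[OF convex_subgroups_scale[OF B(1)] convex_subgroups_scale[OF A(1)]]
    by metis
  then show ?thesis
    using A B by (simp add: coset_mult_zeroless coset_in_zeroless_iff convex_subgroups_closed)
qed

lemma zeroless_mult_commute:
  "\<alpha> \<in> zeroless \<Longrightarrow> \<beta> \<in> zeroless \<Longrightarrow> coset_mult \<alpha> \<beta> = coset_mult \<beta> \<alpha>"
  by (rule coset_mult_commute) (simp_all add: zeroless_def)

section \<open>Units and inverses of zeroless cosets\<close>

context
  fixes a :: "'a::linordered_field" and A
  assumes A: "A \<in> convex_subgroups" and a: "a \<notin> A"
begin

lemma zeroless_rep_nonzero: "a \<noteq> 0"
  using a convex_subgroupsD(1)[OF A] by blast

lemma unit_not_mem: "1 \<notin> (1 / a) *o A"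
  using scale_mem_iff[of "1 / a" a A] zeroless_rep_nonzero a by simp

lemma unit_neutral: "is_neutral zeroless coset_mult (a +o A) (1 +o ((1 / a) *o A))"
  unfolding is_neutral_def
proof (intro conjI ballI impI)
  let ?A = "(1 / a) *o A"
  note a0 = zeroless_rep_nonzero
  have A': "?A \<in> convex_subgroups" by (rule convex_subgroups_scale[OF A])
  show "1 +o ?A \<in> zeroless" using unit_not_mem A' by (simp add: coset_in_zeroless_iff)
  show "coset_mult (a +o A) (1 +o ?A) = a +o A"
    using A A' a a0
    by (simp add: coset_mult_zeroless set_times_rearrange2 convex_subgroups_plus_idem)
  fix \<beta> assume "\<beta> \<in> zeroless" and eq: "coset_mult (a +o A) \<beta> = a +o A"
  then obtain b B where B: "B \<in> convex_subgroups" "\<beta> = b +o B" by (elim zerolessE)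
  then have "a +o A = (a * b) +o (a *o B + b *o A)" using eq A a by (simp add: coset_mult_zeroless)
  from elt_set_plus_eqD[OF A _ this] A B(1)
  have sum: "a *o B + b *o A = A" and mem: "a * b - a \<in> A"
    by (simp_all add: convex_subgroups_closed)
  \<comment> \<open>Dividing \<open>sum\<close> and \<open>mem\<close> by \<open>a\<close> gives
    \<open>B + b *o ?A = ?A\<close> and \<open>b - 1 \<in> ?A\<close>, which say exactly that the
    unit absorbs \<open>\<beta>\<close>.\<close>
  have "?A = (1 / a) *o (a *o B + b *o A)" by (simp add: sum)
  also have "\<dots> = B + b *o ?A"
    using a0 by (simp add: scale_plus_distrib set_times_rearrange2 mult.commute)
  finally have "coset_mult (1 +o ?A) \<beta> = b +o ?A"
    using B A' unit_not_mem by (simp add: coset_mult_zeroless)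
  also have "\<dots> = 1 +o ?A"
  proof (rule coset_eqI[OF A', symmetric])
    show "b - 1 \<in> ?A"
      using set_times_intro2[OF mem, of "1 / a"] a0 by (simp add: algebra_simps)
  qed
  finally show "coset_mult (1 +o ?A) \<beta> = 1 +o ?A" .
qed

lemma zeroless_neutral_op: "neutral_op zeroless coset_mult (a +o A) = 1 +o ((1 / a) *o A)"
  by (rule neutral_op_eq_if_commutative[OF zeroless_mult_commute unit_neutral])

lemma inverse_not_mem: "1 / a \<notin> (1 / a\<^sup>2) *o A"
  using scale_mem_iff[of "1 / a\<^sup>2" a A] zeroless_rep_nonzero a by (simp add: power2_eq_square)

end

text \<open>The product has subgroup part \<open>A/a + A/a = A/a\<close>, that of the unit. The unit
  of the inverse has the same part, since dividing \<open>A/a^2\<close> by \<open>1/a\<close> gives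
  \<open>A/a\<close> again.\<close>

lemma inverse_is_symmetric:
  assumes A: "A \<in> convex_subgroups" and a: "a \<notin> A"
  shows "is_symmetric zeroless coset_mult (a +o A) ((1 / a) +o ((1 / a\<^sup>2) *o A))"
proof -
  let ?A = "(1 / a\<^sup>2) *o A"
  note a0 = zeroless_rep_nonzero[OF A a]
  have A': "?A \<in> convex_subgroups" by (rule convex_subgroups_scale[OF A])
  show ?thesis
    unfolding is_symmetric_def
    using A A' a a0 inverse_not_mem[OF A a]
    by (simp add: coset_in_zeroless_iff zeroless_neutral_op coset_mult_zeroless
        set_times_rearrange2 power2_eq_square convex_subgroups_plus_idem convex_subgroups_closed)
qed

lemma assembly_zeroless: "assembly (zeroless :: 'a::linordered_field set set) coset_mult"
  unfolding assembly_def
proof (intro conjI ballI)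
  show "(zeroless :: 'a set set) \<noteq> {}"
    using coset_in_zeroless_iff[OF zero_convex_subgroup, of "1 :: 'a"] by auto
  fix x y :: "'a set" assume x: "x \<in> zeroless" and y: "y \<in> zeroless"
  then obtain a A b B where A: "A \<in> convex_subgroups" "x = a +o A" "a \<notin> A" "a \<noteq> 0"
    and B: "B \<in> convex_subgroups" "y = b +o B" "b \<notin> B" "b \<noteq> 0"
    by (elim zerolessE)
  show closed: "coset_mult x y \<in> zeroless" by (rule coset_mult_zeroless_closed[OF x y])
  show "coset_mult x y = coset_mult y x" by (rule zeroless_mult_commute[OF x y])
  show "neutral_op zeroless coset_mult (coset_mult x y) = neutral_op zeroless coset_mult x \<or>
        neutral_op zeroless coset_mult (coset_mult x y) = neutral_op zeroless coset_mult y"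
  proof -
    have xy: "coset_mult x y = (a * b) +o (a *o B + b *o A)"
      using A B by (simp add: coset_mult_zeroless)
    have AB: "a *o B + b *o A \<in> convex_subgroups" using A B by (simp add: convex_subgroups_closed)
    \<comment> \<open>The product is already known to be zeroless, so the unit formula applies to
      its representative \<open>a * b\<close>.\<close>
    have "a * b \<notin> a *o B + b *o A" using closed AB by (simp add: xy coset_in_zeroless_iff)
    then have "neutral_op zeroless coset_mult (coset_mult x y)
        = 1 +o ((1 / (a * b)) *o (a *o B + b *o A))"
      using zeroless_neutral_op[OF AB] by (simp add: xy)
    also have "\<dots> = 1 +o ((1 / b) *o B + (1 / a) *o A)"
      using A(4) B(4) by (simp add: scale_plus_distrib set_times_rearrange2)
    finally show ?thesis
      using convex_subgroups_plus_cases[of "(1 / b) *o B" "(1 / a) *o A"] A B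
      by (auto simp: convex_subgroups_scale zeroless_neutral_op)
  qed
  fix z :: "'a set" assume "z \<in> zeroless"
  then show "coset_mult x (coset_mult y z) = coset_mult (coset_mult x y) z"
    using x y by (simp add: zeroless_def coset_mult_assoc)
next
  fix x :: "'a set" assume "x \<in> zeroless"
  then obtain a A where "A \<in> convex_subgroups" "x = a +o A" "a \<notin> A" by (elim zerolessE)
  then show "\<exists>e. is_neutral zeroless coset_mult x e" "\<exists>s. is_symmetric zeroless coset_mult x s"
    using unit_neutral inverse_is_symmetric by blast+
qed

lemma zeroless_symmetric_op:
  assumes "A \<in> convex_subgroups" "a \<notin> A"
  shows "symmetric_op zeroless coset_mult (a +o A) = (1 / a) +o ((1 / a\<^sup>2) *o A)"
  using assms
  by (intro symmetric_op_eqI[OF assembly_zeroless _ inverse_is_symmetric])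
    (simp_all add: coset_in_zeroless_iff)

section \<open>The association of cosets\<close>

text \<open>The magnitude \<open>A\<close> is the coset with representative 0, so the terms
  containing that representative vanish and a magnitude remains.\<close>

lemma magnitude_mult:
  assumes "A \<in> convex_subgroups" "B \<in> convex_subgroups"
  shows "coset_mult A (b +o B) = b *o A + A * B"
  using coset_mult_eq[OF assms, of 0 b] assms
  by (simp add: scale_zero)

lemma coset_add_magnitude:
  assumes "A \<in> convex_subgroups" "B \<in> convex_subgroups"
  shows "coset_add (a +o A) B = a +o (A + B)"
  using coset_add_eq[OF assms, of a 0] by simp

text \<open>The left side contains \<open>bA + cA\<close>, the product with \<open>y + z\<close>
  only \<open>(b + c)A\<close>. The corrections \<open>e(x)y\<close> and \<open>e(x)z\<close>
  restore \<open>bA\<close> and \<open>cA\<close>; the extra \<open>AB\<close> and \<open>AC\<close>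
  they bring are harmless by idempotence.\<close>

lemma coset_distributivity:
  assumes A: "A \<in> convex_subgroups" and B: "B \<in> convex_subgroups" and C: "C \<in> convex_subgroups"
  shows "coset_add (coset_mult (a +o A) (b +o B)) (coset_mult (a +o A) (c +o C)) =
    coset_add (coset_add (coset_mult (a +o A) (coset_add (b +o B) (c +o C)))
      (coset_mult A (b +o B))) (coset_mult A (c +o C))"
proof -
  have absorb: "(b + c) *o A + (b *o A + c *o A) = b *o A + c *o A"
    using A scale_add_subset[of b c A]
    by (simp add: convex_subgroups_plus_absorb convex_subgroups_closed)
  have "(a *o B + b *o A + A * B) + (a *o C + c *o A + A * C)
      = a *o B + a *o C + (b *o A + c *o A) + (A * B + A * C)"
    by (simp add: ac_simps)
  \<comment> \<open>Insert what the right side has in excess: the absorbed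
    \<open>(b + c) *o A\<close> and a second copy of \<open>A * B + A * C\<close>.\<close>
  also have "\<dots> = a *o B + a *o C + ((b + c) *o A + (b *o A + c *o A))
      + ((A * B + A * C) + (A * B + A * C))"
    using A B C by (simp add: absorb convex_subgroups_plus_idem convex_subgroups_closed)
  also have "\<dots> = a *o (B + C) + (b + c) *o A + A * (B + C) + (b *o A + A * B) + (c *o A + A * C)"
    using A B C by (simp add: scale_plus_distrib convex_subgroups_distrib_left ac_simps)
  finally show ?thesis
    using A B C
    by (simp add: coset_mult_eq coset_add_eq magnitude_mult coset_add_magnitude
        convex_subgroups_closed distrib_left)
qed

text \<open>This is the law \<open>e(u(x)) = e(x) d(x)\<close>: the first-order term is
  \<open>A/a\<close>, and \<open>A * A \<subseteq> a *o A\<close> makes the term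
  \<open>AA/a^2\<close> vanish into it.\<close>

lemma magnitude_inverse_mult:
  assumes A: "A \<in> convex_subgroups" and a: "a \<notin> A"
  shows "coset_mult A ((1 / a) +o ((1 / a\<^sup>2) *o A)) = (1 / a) *o A"
proof -
  have "A * A \<subseteq> a *o A" by (rule times_subset_scale[OF A A a])
  then have "(1 / a\<^sup>2) *o (A * A) \<subseteq> (1 / a\<^sup>2) *o (a *o A)" by (rule set_times_mono)
  also have "\<dots> = (1 / a) *o A"
    using zeroless_rep_nonzero[OF A a] by (simp add: set_times_rearrange2 power2_eq_square)
  finally show ?thesis
    using A by (simp add: magnitude_mult scale_times convex_subgroups_closed
        convex_subgroups_plus_absorb)
qed

lemma association_cosets:
  "association (cosets :: 'a::linordered_field set set) coset_add coset_mult"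
  unfolding association_def Let_def zeroless_def[symmetric]
proof (intro conjI ballI impI)
  show "assembly (cosets :: 'a set set) coset_add" by (rule assembly_cosets)
  show "assembly (zeroless :: 'a set set) coset_mult" by (rule assembly_zeroless)
  fix x y :: "'a set" assume x: "x \<in> cosets" and y: "y \<in> cosets"
  then obtain a A b B where A: "A \<in> convex_subgroups" "x = a +o A"
    and B: "B \<in> convex_subgroups" "y = b +o B"
    by (elim cosetsE)
  have mag: "b *o A + A * B \<in> convex_subgroups" using A B by (simp add: convex_subgroups_closed)
  show "coset_mult x y \<in> cosets" by (rule coset_mult_closed[OF x y])
  \<comment> \<open>The product is itself a magnitude, so it serves as its own
    \<open>w\<close>.\<close>
  show "\<exists>w\<in>cosets. coset_mult (neutral_op cosets coset_add x) y = neutral_op cosets coset_add w"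
    using A B coset_neutral_op[OF mag, of 0] cosetsI[OF mag, of 0]
    by (auto simp: coset_neutral_op magnitude_mult)
  show "neutral_op cosets coset_add (coset_mult x y) =
      coset_add (coset_mult (neutral_op cosets coset_add x) y)
        (coset_mult (neutral_op cosets coset_add y) x)"
  proof -
    have "coset_add (b *o A + A * B) (a *o B + B * A) = (b *o A + A * B) + (a *o B + B * A)"
      using coset_add_magnitude[OF mag, of "a *o B + B * A" 0] A B
      by (simp add: convex_subgroups_closed)
    also have "\<dots> = a *o B + b *o A + (A * B + A * B)" by (simp add: ac_simps)
    also have "\<dots> = a *o B + b *o A + A * B"
      using A B by (simp add: convex_subgroups_plus_idem convex_subgroups_closed)
    finally show ?thesis
      using A B by (simp add: coset_neutral_op coset_mult_eq magnitude_mult convex_subgroups_closed)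
  qed
  \<comment> \<open>Replacing \<open>a\<close> by \<open>- a\<close> negates the representative
    \<open>a * b\<close> but leaves \<open>a *o B\<close> unchanged.\<close>
  show "symmetric_op cosets coset_add (coset_mult x y) =
      coset_mult (symmetric_op cosets coset_add x) y"
    using A B by (simp add: coset_symmetric_op coset_mult_eq convex_subgroups_closed scale_minus)
  fix z :: "'a set" assume "z \<in> cosets"
  then obtain c C where "C \<in> convex_subgroups" "z = c +o C" by (elim cosetsE)
  then show "coset_add (coset_mult x y) (coset_mult x z) =
      coset_add (coset_add (coset_mult x (coset_add y z))
        (coset_mult (neutral_op cosets coset_add x) y))
        (coset_mult (neutral_op cosets coset_add x) z)"
    using A B coset_distributivity by (simp add: coset_neutral_op)
next
  fix x :: "'a set" assume "x \<in> cosets" and ne: "x \<noteq> neutral_op cosets coset_add x"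
  then obtain a A where A: "A \<in> convex_subgroups" "x = a +o A" by (elim cosetsE)
  then have "a \<notin> A" using ne coset_absorb by (auto simp: coset_neutral_op)
  then show "neutral_op cosets coset_add (neutral_op zeroless coset_mult x) =
      coset_mult (neutral_op cosets coset_add x) (symmetric_op zeroless coset_mult x)"
    using A by (simp add: zeroless_neutral_op zeroless_symmetric_op coset_neutral_op
        magnitude_inverse_mult convex_subgroups_scale)
qed

theorem theorem4p6:
  assumes nonarch: "\<not> (\<forall>x::'a::linordered_field. \<exists>n::nat. x \<le> of_nat n)"
  shows "let Q = (cosets :: 'a set set);
             e = neutral_op Q coset_add;
             s = symmetric_op Q coset_add;
             Z = Q - magnitudes Q coset_add;
             u = neutral_op Z coset_mult;
             d = symmetric_op Z coset_mult
    in association Q coset_add coset_mult \<and>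
       (\<forall>a. \<forall>A\<in>convex_subgroups.
          e (a +o A) = A \<and>
          s (a +o A) = (- a) +o A \<and>
          (a +o A \<notin> convex_subgroups \<longrightarrow>
             u (a +o A) = 1 +o ((\<lambda>x. x / a) ` A) \<and>
             d (a +o A) = (1 / a) +o ((\<lambda>x. x / a\<^sup>2) ` A)))"
proof -
  have image: "(\<lambda>x. x / b) ` A = (1 / b) *o A" for b :: 'a and A
    by (auto simp: elt_set_times_def)
  \<comment> \<open>Zerolessness is stated through the coset; if \<open>a\<close> were in
    \<open>A\<close>, the coset would collapse to the convex subgroup \<open>A\<close>.\<close>
  have "a \<notin> A" if "A \<in> convex_subgroups" "a +o A \<notin> convex_subgroups" for a :: 'a and A
    using that coset_absorb by metis
  then show ?thesis
    unfolding Let_def zeroless_def[symmetric] image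
    by (simp add: association_cosets coset_neutral_op coset_symmetric_op
        zeroless_neutral_op zeroless_symmetric_op)
qed

end
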